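(* As formal power series in $x$ and $y$, $$\sum_{n\ge k\ge 0}\mathrm{op}_{n,k}(321)\,x^ky^n=\frac{1}{1+x}+\frac{x}{(1+x)^2(1-y)}+\frac{x^2}{(1+x)^2(1-2y)}\,C\!\left(\frac{xy(1-y)}{(1-2y)^2}\right),$$ where $C(z)=\dfrac{1-\sqrt{1-4z}}{2z}$.
   Context: An ordered partition of $[n]=\{1,\dots,n\}$ into $k$ blocks is a sequence $\pi=B_1/B_2/\cdots/B_k$ of nonempty pairwise disjoint subsets with union $[n]$. It contains the pattern $321$ if there exist $1\le i_1<i_2<i_3\le k$ and $b_1\in B_{i_1}$, $b_2\in B_{i_2}$, $b_3\in B_{i_3}$ with $b_1>b_2>b_3$; otherwise it avoids $321$. For $n\ge k\ge1$, $\mathrm{op}_{n,k}(321)$ is the number of ordered partitions of $[n]$ into $k$ blocks that avoid $321$. By convention $\mathrm{op}_{n,0}(321)=\delta_{n,0}$ (equal to $1$ if $n=0$ and $0$ otherwise). $C(z)=\sum_{m\ge0}\frac{1}{m+1}\binom{2m}{m}z^m$ is the generating function of the Catalan numbers. *)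

theory Defs
  imports "HOL-Computational_Algebra.Formal_Power_Series"
begin
unbundle fps_syntax


definition ordered_partition :: "nat \<Rightarrow> nat \<Rightarrow> nat set list \<Rightarrow> bool" where
  "ordered_partition n k Bs \<longleftrightarrow>
     length Bs = k \<and>
     (\<forall>i<k. Bs ! i \<noteq> {}) \<and>
     (\<forall>i<k. \<forall>j<k. i \<noteq> j \<longrightarrow> Bs ! i \<inter> Bs ! j = {}) \<and>
     (\<Union>i<k. Bs ! i) = {1..n}"

definition contains_321 :: "nat set list \<Rightarrow> bool" where
  "contains_321 Bs \<longleftrightarrow>
     (\<exists>i1 i2 i3. i1 < i2 \<and> i2 < i3 \<and> i3 < length Bs \<and>
        (\<exists>b1\<in>Bs ! i1. \<exists>b2\<in>Bs ! i2. \<exists>b3\<in>Bs ! i3. b1 > b2 \<and> b2 > b3))"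

definition op321 :: "nat \<Rightarrow> nat \<Rightarrow> nat" where
  "op321 n k = card {Bs. ordered_partition n k Bs \<and> \<not> contains_321 Bs}"

lemma finite_ordered_partitions: "finite {Bs. ordered_partition n k Bs}"
proof (rule finite_subset)
  show "{Bs. ordered_partition n k Bs} \<subseteq> {Bs. set Bs \<subseteq> Pow {1..n} \<and> length Bs = k}"
    by (fastforce simp: ordered_partition_def in_set_conv_nth)
  show "finite {Bs :: nat set list. set Bs \<subseteq> Pow {1..n} \<and> length Bs = k}"
    by (intro finite_lists_length_eq) simp
qed

text \<open>The convention for zero blocks is not imposed separately: the empty list is the only list
  of length zero, and its union is empty.\<close>

lemma op321_zero_blocks: "op321 n 0 = (if n = 0 then 1 else 0)"
proof -
  have "{Bs. ordered_partition n 0 Bs \<and> \<not> contains_321 Bs} = (if n = 0 then {[]} else {})"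
    by (auto simp: ordered_partition_def contains_321_def)
  then show ?thesis by (simp add: op321_def)
qed

definition catalan_gf :: "rat fps" where
  "catalan_gf = Abs_fps (\<lambda>m. 1 / (of_nat m + 1) * of_nat ((2 * m) choose m))"

lemma gbinomial_half_catalan:
  "((1/2 :: rat) gchoose Suc m) * (-4) ^ Suc m
     = - 2 * (1 / (of_nat m + 1) * of_nat ((2 * m) choose m))"
proof (induction m)
  case 0
  then show ?case by simp
next
  case (Suc m)
  have c1: "of_nat (Suc m) * (of_nat (2 * Suc m choose Suc m) :: rat)
              = of_nat (2 * Suc m) * of_nat (Suc (2 * m) choose m)"
    using Suc_times_binomial_eq[of "Suc (2 * m)" m]
    by (metis mult.commute mult_2 add_Suc add_Suc_right of_nat_mult)
  have c2: "of_nat (Suc m) * (of_nat (Suc (2 * m) choose m) :: rat)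
              = of_nat (Suc (2 * m)) * of_nat (2 * m choose m)"
  proof -
    have "Suc (2 * m) choose m = Suc (2 * m) choose Suc m"
      using binomial_symmetric[of m "Suc (2 * m)"] by (simp add: Suc_diff_le mult_2)
    then have "Suc m * (Suc (2 * m) choose m) = Suc (2 * m) * (2 * m choose m)"
      using Suc_times_binomial_eq[of "2 * m" m] by (simp only: mult.commute)
    then show ?thesis by (metis of_nat_mult)
  qed
  have c: "(of_nat m + 1) * (of_nat (2 * Suc m choose Suc m) :: rat)
             = 2 * (2 * of_nat m + 1) * of_nat (2 * m choose m)"
  proof -
    have "(of_nat (2 * Suc m choose Suc m) :: rat) = 2 * of_nat (Suc (2 * m) choose m)"
    proof -
      have "of_nat (Suc m) * (of_nat (2 * Suc m choose Suc m) :: rat)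
              = of_nat (Suc m) * (2 * of_nat (Suc (2 * m) choose m))"
        unfolding c1 by simp
      then show ?thesis by (simp only: mult_left_cancel of_nat_eq_0_iff)
    qed
    moreover have "(of_nat m + 1) * (of_nat (Suc (2 * m) choose m) :: rat)
        = (2 * of_nat m + 1) * of_nat (2 * m choose m)"
      using c2 by (simp only: of_nat_Suc of_nat_mult of_nat_numeral add.commute)
    ultimately show ?thesis by (simp only: mult.assoc mult.left_commute[of _ "2 :: rat"])
  qed
  have "((1/2 :: rat) gchoose Suc (Suc m)) * of_nat (Suc (Suc m))
          = (1/2 - of_nat (Suc m)) * ((1/2) gchoose Suc m)"
    using gbinomial_mult_1[of "1/2 :: rat" "Suc m"] by (simp add: algebra_simps)
  then have "((1/2 :: rat) gchoose Suc (Suc m))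
          = (1/2 - of_nat (Suc m)) / of_nat (Suc (Suc m)) * ((1/2) gchoose Suc m)"
    by (simp add: field_simps del: of_nat_Suc)
  then have "((1/2 :: rat) gchoose Suc (Suc m)) * (-4) ^ Suc (Suc m)
        = (-4) * (1/2 - of_nat (Suc m)) / of_nat (Suc (Suc m)) *
            (((1/2) gchoose Suc m) * (-4) ^ Suc m)"
    by (simp only: power_Suc times_divide_eq_left times_divide_eq_right ac_simps)
  also have "\<dots> = (-4) * (1/2 - of_nat (Suc m)) / of_nat (Suc (Suc m)) *
            (- 2 * (1 / (of_nat m + 1) * of_nat ((2 * m) choose m)))"
    by (simp only: Suc.IH)
  also have "\<dots> = - 2 / of_nat (Suc (Suc m)) *
            ((2 * (2 * of_nat m + 1) * of_nat (2 * m choose m)) / (of_nat m + 1))"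
  proof -
    have "(-4) * (1/2 - of_nat (Suc m)) = (2 * (2 * of_nat m + 1) :: rat)"
      by (simp add: algebra_simps)
    then show ?thesis
      by (simp only: times_divide_eq_left times_divide_eq_right divide_divide_eq_left
          mult_1_left ac_simps)
  qed
  also have "\<dots> = - 2 / of_nat (Suc (Suc m)) * of_nat (2 * Suc m choose Suc m)"
  proof -
    have "(of_nat m + 1 :: rat) \<noteq> 0"
      using of_nat_neq_0[of m, where 'a = rat] by (simp add: add.commute)
    then show ?thesis
      unfolding c[symmetric] by (simp only: nonzero_mult_div_cancel_left not_False_eq_True)
  qed
  finally show ?case by (simp add: field_simps)
qed

text \<open>The closed form \<open>(1 - sqrt (1 - 4z)) / (2z)\<close>; the first argument of \<^const>\<open>fps_radical\<close>
  picks \<open>1\<close> as the square root of the constant coefficient \<open>1\<close>.\<close>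

lemma catalan_gf_closed_form:
  "catalan_gf = (1 - fps_radical (\<lambda>_ _. 1) 2 (1 - 4 * fps_X)) / (2 * fps_X)"
proof -
  define s :: "rat fps" where "s = fps_binomial (1/2) oo (fps_const (-4) * fps_X)"
  have nth: "s $ m = ((1/2) gchoose m) * (-4) ^ m" for m
    unfolding s_def fps_nth_compose_linear by simp
  have s: "s = 1 - 2 * fps_X * catalan_gf"
  proof (rule fps_ext)
    fix m
    show "s $ m = (1 - 2 * fps_X * catalan_gf) $ m"
    proof (cases m)
      case 0
      then show ?thesis by (simp add: nth mult.assoc)
    next
      case (Suc k)
      have "(1 - 2 * fps_X * catalan_gf) $ Suc k = - 2 * catalan_gf $ k"
        by (simp add: mult.assoc numeral_fps_const)
      then show ?thesis
        using gbinomial_half_catalan[of k] by (simp only: Suc nth) (simp add: catalan_gf_def)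
    qed
  qed
  have "s ^ 2 = (fps_binomial (1/2) ^ 2) oo (fps_const (-4) * fps_X)"
    unfolding s_def by (simp add: fps_compose_power)
  also have "\<dots> = 1 - 4 * fps_X"
    by (simp add: fps_binomial_power fps_binomial_1 fps_compose_add_distrib numeral_fps_const
        flip: fps_const_neg)
  finally have sq: "s ^ Suc 1 = 1 - 4 * fps_X" by (simp add: numeral_2_eq_2)
  have "s = fps_radical (\<lambda>_ _. 1) (Suc 1) (1 - 4 * fps_X)"
    by (rule iffD1[OF radical_unique sq]) (auto simp: nth)
  then have "1 - fps_radical (\<lambda>_ _. 1) 2 (1 - 4 * fps_X) = catalan_gf * (2 * fps_X)"
    using s by (simp add: numeral_2_eq_2 algebra_simps)
  then show ?thesis by simp
qed

text \<open>Series in \<open>x\<close> and \<open>y\<close> are series in \<open>y\<close> whose coefficients are series in \<open>x\<close>: the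
  coefficient of \<open>x\<^sup>k y\<^sup>n\<close> in \<open>F\<close> is \<open>F $ n $ k\<close>.\<close>

abbreviation var_x :: "rat fps fps" where
  "var_x \<equiv> fps_const fps_X"

abbreviation var_y :: "rat fps fps" where
  "var_y \<equiv> fps_X"

text \<open>The substitution \<open>F(G(x, y))\<close>. Composition of power series is meaningful only for
  \<open>G $ 0 = 0\<close>, that is, for \<open>G\<close> divisible by \<open>y\<close>.\<close>

definition subst_xy :: "rat fps \<Rightarrow> rat fps fps \<Rightarrow> rat fps fps" where
  "subst_xy F G = Abs_fps (\<lambda>m. fps_const (F $ m)) oo G"

text \<open>The coefficients of \<^typ>\<open>rat fps fps\<close> form no field, so division on it is not covered by the
  library's field lemmas; it is the true quotient whenever the constant coefficient of the
  denominator is nonzero.\<close>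

lemma divide_xy_unit:
  fixes F G :: "rat fps fps"
  assumes "G $ 0 $ 0 \<noteq> 0"
  shows "F / G * G = F"
proof -
  have "G $ 0 \<noteq> 0" using assms by auto
  then have "F / G = F * inverse G" by (rule fps_divide_unit)
  moreover have "inverse G * G = 1"
  proof -
    have "inverse (G $ 0) * G $ 0 = 1" using assms by (rule inverse_mult_eq_1)
    then show ?thesis
      using fps_right_inverse[of G "inverse (G $ 0)"]
      by (simp add: fps_inverse_def[of G] mult.commute)
  qed
  ultimately show ?thesis by (simp add: mult.assoc)
qed

lemma substituted_series_constant_coeff:
  "(var_x * var_y * (1 - var_y) / (1 - 2 * var_y)\<^sup>2) $ 0 = 0"
proof -
  have "(1 - 2 * var_y)\<^sup>2 $ 0 = 1" by (simp add: fps_power_zeroth)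
  then show ?thesis by (subst fps_divide_unit) simp_all
qed

end

theory Submission
  imports Defs
begin

text \<open>
  Recording for each element of \<open>[n]\<close> the index of its block turns an ordered partition into a
  word of length \<open>n\<close> that uses each of its \<open>k\<close> letters; block pattern \<open>321\<close> becomes a strictly
  decreasing subsequence of length three. Dropping the condition that every letter occurs makes
  such words easy to build from left to right, and the two counts are related by
  \<open>f(n,k) = \<Sum>\<^sub>j (k choose j) op(n,j)\<close> (lemma \<open>card_words_binomial\<close>), which for series in the
  alphabet size is the substitution \<open>v = x / (1 + x)\<close>
  (lemma \<open>binomial_transform_compose\<close>).

  For the left-to-right construction, all that matters about a prefix is its maximum \<open>m\<close> and the
  largest letter \<open>a\<close> that has a larger letter before it: the next letter must be at least \<open>a\<close>.
  The number of ways to append \<open>r\<close> letters depends only on \<open>d = m - a\<close> and on the number \<open>e\<close> of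
  letters above \<open>m\<close>. With \<open>W\<^sub>d = \<Sum>\<^sub>r\<^sub>,\<^sub>e W(r,d,e) v\<^sup>e y\<^sup>r\<close> the two kinds of continuation give
  \<open>W\<^sub>d = 1 / (1 - v) + y (W\<^sub>1 + \<dots> + W\<^sub>d + \<Sum>\<^sub>j v\<^sup>j W\<^sub>d\<^sub>+\<^sub>j)\<close>.

  The kernel method shows what the solution looks like. In the generating function
  \<open>\<Sum>\<^sub>d W\<^sub>d u\<^sup>d\<close> the kernel is quadratic in \<open>u\<close>, whereas the right-hand side, once \<open>W\<^sub>0 = 1 / (1 - v) + y
  \<Sum>\<^sub>j v\<^sup>j W\<^sub>j\<close> is used, is linear in \<open>u\<close>. It cancels one of the two roots, only one simple pole in
  \<open>u\<close> survives, and therefore \<open>W\<^sub>d = g A\<^sup>d\<close> is a geometric progression. Substituting this form into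
  the recurrence leaves two equations, solved by
  \<open>A = 1 + y c / (1 - 2y)\<close> and \<open>g = 1 / (1 - y) + x c / (1 - 2y)\<close>, where \<open>c\<close> satisfies
  \<open>c = 1 + x y (1 - y) / (1 - 2y)\<^sup>2 c\<^sup>2\<close>, the Catalan equation at the argument of the theorem.
  Since the recurrence determines \<open>W\<close>, it is enough to verify it for \<open>g A\<^sup>d\<close>
  (lemma \<open>completions_gf_geometric\<close>). The value \<open>d = 0\<close> counts all words, and undoing the
  substitution \<open>v = x / (1 + x)\<close> gives \<open>(1 + x)\<^sup>2 P = 1 + x + x g\<close> for the series \<open>P\<close> of
  \<open>op(n,k)\<close>.
\<close>

section \<open>Ordered partitions as surjective words\<close>

definition contains_321_word :: "nat list \<Rightarrow> bool" where
  "contains_321_word w \<longleftrightarrow>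
     (\<exists>i j l. i < j \<and> j < l \<and> l < length w \<and> w ! i > w ! j \<and> w ! j > w ! l)"

definition onto_words :: "nat \<Rightarrow> nat set \<Rightarrow> nat list set" where
  "onto_words n S = {w. length w = n \<and> set w = S \<and> \<not> contains_321_word w}"

definition words :: "nat \<Rightarrow> nat set \<Rightarrow> nat list set" where
  "words n S = {w. length w = n \<and> set w \<subseteq> S \<and> \<not> contains_321_word w}"

lemma finite_words: "finite S \<Longrightarrow> finite (words n S)"
  by (rule finite_subset[OF _ finite_lists_length_eq[of S n]]) (auto simp: words_def)

text \<open>Elements of \<open>[n]\<close> start at \<open>1\<close> and positions in a list at \<open>0\<close>, hence the shift.\<close>

definition blocks_of_word :: "nat \<Rightarrow> nat \<Rightarrow> nat list \<Rightarrow> nat set list" where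
  "blocks_of_word n k w = map (\<lambda>i. {b \<in> {1..n}. w ! (b - 1) = i}) [0..<k]"

text \<open>The inverse permutation of \<open>321\<close> is \<open>321\<close> itself, so exchanging positions and values
  keeps the pattern: blocks \<open>i1 < i2 < i3\<close> with \<open>b1 > b2 > b3\<close> are the letters
  \<open>i3 > i2 > i1\<close> at the increasing positions \<open>b3 - 1 < b2 - 1 < b1 - 1\<close>.\<close>

lemma contains_321_blocks_of_word:
  assumes "length w = n" "set w \<subseteq> {..<k}"
  shows "contains_321 (blocks_of_word n k w) \<longleftrightarrow> contains_321_word w"
proof
  assume "contains_321 (blocks_of_word n k w)"
  then obtain i1 i2 i3 b1 b2 b3 where *: "i1 < i2" "i2 < i3" "i3 < k"
    "b1 \<in> {1..n}" "w ! (b1 - 1) = i1" "b2 \<in> {1..n}" "w ! (b2 - 1) = i2"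
    "b3 \<in> {1..n}" "w ! (b3 - 1) = i3" "b1 > b2" "b2 > b3"
    unfolding contains_321_def blocks_of_word_def by auto
  then have "b3 - 1 < b2 - 1" "b2 - 1 < b1 - 1" "b1 - 1 < length w"
    using assms by auto
  with * show "contains_321_word w"
    unfolding contains_321_word_def by blast
next
  assume "contains_321_word w"
  then obtain i j l where *: "i < j" "j < l" "l < n" "w ! i > w ! j" "w ! j > w ! l"
    using assms unfolding contains_321_word_def by blast
  have lt: "w ! p < k" if "p < n" for p
    using assms that nth_mem by blast
  have "Suc l \<in> blocks_of_word n k w ! (w ! l)" "Suc j \<in> blocks_of_word n k w ! (w ! j)"
    "Suc i \<in> blocks_of_word n k w ! (w ! i)"
    using * lt by (auto simp: blocks_of_word_def)
  moreover have "w ! i < length (blocks_of_word n k w)"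
    using * lt by (simp add: blocks_of_word_def)
  ultimately show "contains_321 (blocks_of_word n k w)"
    unfolding contains_321_def using * by (meson Suc_mono)
qed

lemma op321_eq_card_onto_words: "op321 n k = card (onto_words n {..<k})"
proof -
  have "bij_betw (blocks_of_word n k) (onto_words n {..<k})
          {Bs. ordered_partition n k Bs \<and> \<not> contains_321 Bs}"
    unfolding bij_betw_def
  proof (intro conjI inj_onI equalityI subsetI)
    fix w w'
    assume w: "w \<in> onto_words n {..<k}" and w': "w' \<in> onto_words n {..<k}"
      and eq: "blocks_of_word n k w = blocks_of_word n k w'"
    show "w = w'"
    proof (rule nth_equalityI)
      show "length w = length w'" using w w' by (simp add: onto_words_def)
      fix p assume p: "p < length w"
      then have "w ! p < k" using w nth_mem by (auto simp: onto_words_def)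
      moreover have "Suc p \<in> blocks_of_word n k w ! (w ! p)"
        using \<open>w ! p < k\<close> p w by (auto simp: blocks_of_word_def onto_words_def)
      ultimately show "w ! p = w' ! p"
        unfolding eq by (simp add: blocks_of_word_def)
    qed
  next
    fix Bs assume "Bs \<in> blocks_of_word n k ` onto_words n {..<k}"
    then obtain w where w: "w \<in> onto_words n {..<k}" and Bs: "Bs = blocks_of_word n k w" by blast
    have nth: "Bs ! i = {b \<in> {1..n}. w ! (b - 1) = i}" if "i < k" for i
      using that by (simp add: Bs blocks_of_word_def)
    have "ordered_partition n k Bs"
      unfolding ordered_partition_def
    proof (intro conjI allI impI)
      show "length Bs = k" by (simp add: Bs blocks_of_word_def)
    next
      fix i assume "i < k"
      then have "i \<in> set w" using w by (simp add: onto_words_def)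
      then obtain p where "p < length w" "w ! p = i" by (meson in_set_conv_nth)
      then have "p < n" "w ! p = i" using w by (simp_all add: onto_words_def)
      then have "Suc p \<in> Bs ! i" using \<open>i < k\<close> by (simp add: nth)
      then show "Bs ! i \<noteq> {}" by blast
    next
      fix i j assume "i < k" "j < k" "i \<noteq> j"
      then show "Bs ! i \<inter> Bs ! j = {}" unfolding nth[OF \<open>i < k\<close>] nth[OF \<open>j < k\<close>] by blast
    next
      have "w ! (b - 1) < k" if "b \<in> {1..n}" for b
      proof -
        have len: "length w = n" and set: "set w = {..<k}"
          using w unfolding onto_words_def by blast+
        have "b - 1 < length w" unfolding len using that by auto
        then have "w ! (b - 1) \<in> set w" by (rule nth_mem)
        then show ?thesis unfolding set by simp
      qed
      then show "(\<Union>i<k. Bs ! i) = {1..n}" by (auto simp: nth)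
    qed
    moreover have "\<not> contains_321 Bs"
      using w by (simp add: Bs contains_321_blocks_of_word onto_words_def)
    ultimately show "Bs \<in> {Bs. ordered_partition n k Bs \<and> \<not> contains_321 Bs}" by simp
  next
    fix Bs assume "Bs \<in> {Bs. ordered_partition n k Bs \<and> \<not> contains_321 Bs}"
    then have len: "length Bs = k" and ne: "\<And>i. i < k \<Longrightarrow> Bs ! i \<noteq> {}"
      and disj: "\<And>i j. i < k \<Longrightarrow> j < k \<Longrightarrow> i \<noteq> j \<Longrightarrow> Bs ! i \<inter> Bs ! j = {}"
      and un: "(\<Union>i<k. Bs ! i) = {1..n}" and av: "\<not> contains_321 Bs"
      by (auto simp: ordered_partition_def)
    have "\<exists>i<k. Suc p \<in> Bs ! i" if "p < n" for p
    proof -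
      have "Suc p \<in> (\<Union>i<k. Bs ! i)" using that by (simp add: un)
      then show ?thesis by blast
    qed
    then obtain h where h: "\<And>p. p < n \<Longrightarrow> h p < k \<and> Suc p \<in> Bs ! h p" by metis
    have h_eq: "h p = i" if "p < n" "i < k" "Suc p \<in> Bs ! i" for p i
      using disj[of "h p" i] h[of p] that by blast
    define w where "w = map h [0..<n]"
    have sub: "b \<in> {1..n}" if "b \<in> Bs ! i" "i < k" for b i
      using un that by blast
    have "set w = {..<k}"
    proof (intro equalityI subsetI)
      fix i assume "i \<in> set w" then show "i \<in> {..<k}" using h by (auto simp: w_def)
    next
      fix i assume i: "i \<in> {..<k}"
      then obtain b where b: "b \<in> Bs ! i" using ne by blast
      with i sub have b1: "b \<in> {1..n}" by simp
      then have "h (b - 1) = i" using b i by (intro h_eq) auto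
      moreover have "b - 1 < n" using b1 by auto
      ultimately show "i \<in> set w" by (auto simp: w_def)
    qed
    have blk: "blocks_of_word n k w = Bs"
    proof (rule nth_equalityI)
      show "length (blocks_of_word n k w) = length Bs" by (simp add: blocks_of_word_def len)
      fix i assume "i < length (blocks_of_word n k w)"
      then have i: "i < k" by (simp add: blocks_of_word_def)
      have "b \<in> {1..n} \<and> w ! (b - 1) = i \<longleftrightarrow> b \<in> Bs ! i" for b
      proof
        assume b: "b \<in> {1..n} \<and> w ! (b - 1) = i"
        then have "b - 1 < n" "h (b - 1) = i" by (auto simp: w_def)
        with h[of "b - 1"] b show "b \<in> Bs ! i" by auto
      next
        assume b: "b \<in> Bs ! i"
        with i sub have b1: "b \<in> {1..n}" by simp
        moreover have "h (b - 1) = i" using b i b1 by (intro h_eq) auto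
        moreover have "b - 1 < n" using b1 by auto
        ultimately show "b \<in> {1..n} \<and> w ! (b - 1) = i" by (auto simp: w_def)
      qed
      then show "blocks_of_word n k w ! i = Bs ! i"
        using i by (auto simp: blocks_of_word_def)
    qed
    have "w \<in> onto_words n {..<k}"
      using av contains_321_blocks_of_word[of w n k] \<open>set w = {..<k}\<close>
      by (simp add: onto_words_def blk) (simp add: w_def)
    with blk show "Bs \<in> blocks_of_word n k ` onto_words n {..<k}" by blast
  qed
  then show ?thesis unfolding op321_def by (simp add: bij_betw_same_card)
qed

section \<open>From surjective words to all words\<close>

lemma contains_321_word_map:
  assumes "strict_mono_on S h" "set w \<subseteq> S"
  shows "contains_321_word (map h w) \<longleftrightarrow> contains_321_word w"
proof -
  have "h (w ! i) < h (w ! j) \<longleftrightarrow> w ! i < w ! j" if "i < length w" "j < length w" for i j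
    using assms that nth_mem
    by (meson strict_mono_on_less subsetD)
  then have "(i < j \<and> j < l \<and> l < length w \<and> map h w ! i > map h w ! j \<and> map h w ! j > map h w ! l) \<longleftrightarrow>
      (i < j \<and> j < l \<and> l < length w \<and> w ! i > w ! j \<and> w ! j > w ! l)" for i j l
    by (cases "i < j \<and> j < l \<and> l < length w") auto
  then show ?thesis
    unfolding contains_321_word_def length_map by blast
qed

text \<open>Only the relative order of the letters matters, so the alphabet can be replaced by the ranks
  of its elements.\<close>

lemma card_onto_words:
  assumes "finite S"
  shows "card (onto_words n S) = card (onto_words n {..<card S})"
proof -
  define h where "h i = sorted_list_of_set S ! i" for i
  have sm: "strict_mono_on {..<card S} h"
    using assms by (auto simp: strict_mono_on_def h_def sorted_wrt_nth_less
        intro!: sorted_wrt_nth_less[OF strict_sorted_list_of_set])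
  have img: "h ` {..<card S} = S"
    using assms unfolding h_def
    by (metis bij_betw_def bij_betw_nth distinct_sorted_list_of_set
        sorted_list_of_set.length_sorted_key_list_of_set sorted_list_of_set.set_sorted_key_list_of_set)
  have inj: "inj_on h {..<card S}"
    using sm by (rule strict_mono_on_imp_inj_on)
  have "bij_betw (map h) (onto_words n {..<card S}) (onto_words n S)"
    unfolding bij_betw_def
  proof (intro conjI inj_onI equalityI subsetI)
    fix w w' assume "w \<in> onto_words n {..<card S}" "w' \<in> onto_words n {..<card S}" "map h w = map h w'"
    then show "w = w'"
      using inj by (auto simp: onto_words_def intro: map_inj_on)
  next
    fix w assume "w \<in> map h ` onto_words n {..<card S}"
    then show "w \<in> onto_words n S"
      using contains_321_word_map[OF sm] img by (auto simp: onto_words_def)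
  next
    fix w assume w: "w \<in> onto_words n S"
    then have "set w = h ` {..<card S}" by (simp add: onto_words_def img)
    define w' where "w' = map (inv_into {..<card S} h) w"
    have 1: "map h w' = w"
      unfolding w'_def using \<open>set w = _\<close>
      by (auto simp: o_def f_inv_into_f intro!: map_idI)
    have 2: "set w' = {..<card S}"
      unfolding w'_def using \<open>set w = _\<close> inj by (simp add: inv_into_image_cancel)
    have "w' \<in> onto_words n {..<card S}"
    proof -
      have "length w' = length w" by (simp add: w'_def)
      moreover have "contains_321_word w' \<longleftrightarrow> contains_321_word w"
        using contains_321_word_map[OF sm, of w'] 1 2 by simp
      ultimately show ?thesis using w 2 by (simp add: onto_words_def)
    qed
    with 1 show "w \<in> map h ` onto_words n {..<card S}" by blast
  qed
  then show ?thesis by (simp add: bij_betw_same_card)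
qed

text \<open>Sort the words by the set of letters that occur.\<close>

lemma card_words_binomial:
  "card (words n {..<k}) = (\<Sum>j\<le>k. (k choose j) * op321 n j)"
proof -
  have "words n {..<k} = (\<Union>S\<in>Pow {..<k}. onto_words n S)"
    by (auto simp: words_def onto_words_def)
  also have "card \<dots> = (\<Sum>S\<in>Pow {..<k}. card (onto_words n S))"
  proof (rule card_UN_disjoint)
    show "\<forall>S\<in>Pow {..<k}. finite (onto_words n S)"
      by (auto intro!: finite_subset[OF _ finite_words[of "{..<k}" n]] simp: words_def onto_words_def)
  qed (auto simp: onto_words_def)
  also have "\<dots> = (\<Sum>S\<in>Pow {..<k}. op321 n (card S))"
    by (intro sum.cong refl) (metis card_onto_words finite_lessThan finite_subset PowD op321_eq_card_onto_words)
  also have "\<dots> = (\<Sum>j\<le>k. \<Sum>S\<in>{S\<in>Pow {..<k}. card S = j}. op321 n (card S))"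
  proof (rule sum.group[symmetric])
    show "card ` Pow {..<k} \<subseteq> {..k}"
      using card_mono[of "{..<k}"] by fastforce
  qed simp_all
  also have "\<dots> = (\<Sum>j\<le>k. (k choose j) * op321 n j)"
  proof (intro sum.cong refl)
    fix j
    have "(\<Sum>S\<in>{S\<in>Pow {..<k}. card S = j}. op321 n (card S)) = card {S. S \<subseteq> {..<k} \<and> card S = j} * op321 n j"
      by simp
    then show "(\<Sum>S\<in>{S\<in>Pow {..<k}. card S = j}. op321 n (card S)) = (k choose j) * op321 n j"
      by (simp add: n_subsets)
  qed
  finally show ?thesis .
qed

lemma op321_eq_0:
  assumes "n < k"
  shows "op321 n k = 0"
proof -
  have "w \<notin> onto_words n {..<k}" for w
  proof
    assume "w \<in> onto_words n {..<k}"
    then have w: "set w = {..<k}" "length w = n" unfolding onto_words_def by blast+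
    have "card {..<k} \<le> n" using card_length[of w] unfolding w .
    with assms show False by simp
  qed
  then have "onto_words n {..<k} = {}" by blast
  then show ?thesis by (simp add: op321_eq_card_onto_words)
qed

section \<open>Building words from left to right\<close>

text \<open>The words that may follow a prefix with maximum \<open>m\<close> in which \<open>a\<close> is the largest letter
  preceded by a larger one, or \<open>0\<close> if there is none. The three conditions exclude a pattern \<open>321\<close>
  whose last one, last three and last two letters, respectively, lie in the continuation.\<close>

definition safe_from :: "nat \<Rightarrow> nat \<Rightarrow> nat list \<Rightarrow> bool" where
  "safe_from a m w \<longleftrightarrow> (\<forall>c\<in>set w. a \<le> c) \<and> \<not> contains_321_word w \<and>
     (\<forall>i j. i < j \<longrightarrow> j < length w \<longrightarrow> w ! j < w ! i \<longrightarrow> m \<le> w ! i)"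

lemma contains_321_word_Cons:
  "contains_321_word (c # w) \<longleftrightarrow> contains_321_word w \<or>
     (\<exists>i j. i < j \<and> j < length w \<and> w ! j < w ! i \<and> w ! i < c)"
  (is "_ \<longleftrightarrow> _ \<or> ?R")
proof
  assume "contains_321_word (c # w)"
  then obtain i j l where *: "i < j" "j < l" "l < Suc (length w)"
    "(c # w) ! i > (c # w) ! j" "(c # w) ! j > (c # w) ! l"
    unfolding contains_321_word_def by auto
  obtain j' l' where "j = Suc j'" "l = Suc l'"
    using * by (metis less_nat_zero_code not0_implies_Suc)
  then show "contains_321_word w \<or> ?R"
    using * by (cases i) (auto simp: contains_321_word_def)
next
  assume "contains_321_word w \<or> ?R"
  then show "contains_321_word (c # w)"
  proof
    assume "contains_321_word w"
    then obtain i j l where "i < j" "j < l" "l < length w" "w ! i > w ! j" "w ! j > w ! l"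
      unfolding contains_321_word_def by auto
    then show ?thesis
      unfolding contains_321_word_def
      by (intro exI[of _ "Suc i"] exI[of _ "Suc j"] exI[of _ "Suc l"]) auto
  next
    assume ?R
    then obtain i j where "i < j" "j < length w" "w ! j < w ! i" "w ! i < c" by auto
    then show ?thesis
      unfolding contains_321_word_def
      by (intro exI[of _ 0] exI[of _ "Suc i"] exI[of _ "Suc j"]) auto
  qed
qed

lemma safe_from_Nil [simp]: "safe_from a m []"
  by (simp add: safe_from_def contains_321_word_def)

text \<open>A letter \<open>c\<close> that is at least \<open>m\<close> becomes the new maximum; a smaller one is preceded by the
  larger letter \<open>m\<close> and becomes the new lower bound. In each case the condition for the new pair
  implies the one for the old pair.\<close>

lemma safe_from_Cons:
  assumes "a \<le> m"
  shows "safe_from a m (c # w) \<longleftrightarrow> (if m \<le> c then safe_from a c w else a \<le> c \<and> safe_from c m w)"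
proof -
  have all_nat: "(\<forall>i. P i) \<longleftrightarrow> P 0 \<and> (\<forall>i. P (Suc i))" for P :: "nat \<Rightarrow> bool"
    by (metis not0_implies_Suc)
  have inv: "(\<forall>i j. i < j \<longrightarrow> j < length (c # w) \<longrightarrow> (c # w) ! j < (c # w) ! i \<longrightarrow> m \<le> (c # w) ! i) \<longleftrightarrow>
     (c < m \<longrightarrow> (\<forall>b\<in>set w. c \<le> b)) \<and>
     (\<forall>i j. i < j \<longrightarrow> j < length w \<longrightarrow> w ! j < w ! i \<longrightarrow> m \<le> w ! i)"
    by (subst all_nat, subst (1 2) all_nat)
      (auto simp: all_set_conv_all_nth not_less[symmetric])
  have "safe_from a m (c # w) \<longleftrightarrow> a \<le> c \<and> (\<forall>b\<in>set w. a \<le> b) \<and> \<not> contains_321_word w \<and>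
     (\<forall>i j. i < j \<longrightarrow> j < length w \<longrightarrow> w ! j < w ! i \<longrightarrow> c \<le> w ! i) \<and>
     (c < m \<longrightarrow> (\<forall>b\<in>set w. c \<le> b)) \<and>
     (\<forall>i j. i < j \<longrightarrow> j < length w \<longrightarrow> w ! j < w ! i \<longrightarrow> m \<le> w ! i)"
    unfolding safe_from_def inv contains_321_word_Cons by (auto simp: not_less[symmetric])
  then show ?thesis
    using assms unfolding safe_from_def by (auto intro: order_trans)
qed

text \<open>The number of ways to append \<open>r\<close> letters when \<open>m - a = d\<close> and \<open>e\<close> letters lie above \<open>m\<close>.
  Appending \<open>c < m\<close> changes \<open>d\<close> to some \<open>i\<close> in \<open>{1..d}\<close>; appending \<open>m + j\<close> moves \<open>j\<close> units from
  \<open>e\<close> to \<open>d\<close>.\<close>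

fun completions :: "nat \<Rightarrow> nat \<Rightarrow> nat \<Rightarrow> nat" where
  "completions 0 d e = 1"
| "completions (Suc r) d e =
     (\<Sum>i=1..d. completions r i e) + (\<Sum>j\<le>e. completions r (d + j) (e - j))"

lemma card_safe_from:
  assumes "a \<le> m" "m < k"
  shows "card {w. length w = r \<and> set w \<subseteq> {..<k} \<and> safe_from a m w} = completions r (m - a) (k - 1 - m)"
  using assms
proof (induction r arbitrary: a m)
  case 0
  have "{w. length w = 0 \<and> set w \<subseteq> {..<k} \<and> safe_from a m w} = {[]}" by auto
  then show ?case by simp
next
  case (Suc r)
  let ?N = "\<lambda>a m. {w. length w = r \<and> set w \<subseteq> {..<k} \<and> safe_from a m w}"
  define M where "M c = (if m \<le> c then ?N a c else ?N c m)" for c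
  have fin: "finite (?N a m)" for a m
    by (rule finite_subset[OF _ finite_lists_length_eq[of "{..<k}" r]]) auto
  have "{w. length w = Suc r \<and> set w \<subseteq> {..<k} \<and> safe_from a m w} = (\<Union>c\<in>{a..<k}. (#) c ` M c)"
  proof (rule set_eqI)
    fix w
    show "w \<in> {w. length w = Suc r \<and> set w \<subseteq> {..<k} \<and> safe_from a m w} \<longleftrightarrow>
        w \<in> (\<Union>c\<in>{a..<k}. (#) c ` M c)"
      using Suc.prems by (cases w) (auto simp: M_def safe_from_Cons split: if_splits)
  qed
  also have "card \<dots> = (\<Sum>c\<in>{a..<k}. card ((#) c ` M c))"
    by (rule card_UN_disjoint) (auto simp: M_def fin)
  also have "\<dots> = (\<Sum>c\<in>{a..<k}. card (M c))"
    by (intro sum.cong refl card_image) auto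
  also have "\<dots> = (\<Sum>c\<in>{a..<m}. card (M c)) + (\<Sum>c\<in>{m..<k}. card (M c))"
    using Suc.prems by (simp add: sum.atLeastLessThan_concat)
  also have "(\<Sum>c\<in>{a..<m}. card (M c)) = (\<Sum>c\<in>{a..<m}. completions r (m - c) (k - 1 - m))"
    using Suc.prems by (intro sum.cong refl) (simp add: M_def Suc.IH)
  also have "\<dots> = (\<Sum>i=1..m - a. completions r i (k - 1 - m))"
    using Suc.prems
    by (intro sum.reindex_bij_witness[of _ "\<lambda>i. m - i" "\<lambda>c. m - c"]) auto
  also have "(\<Sum>c\<in>{m..<k}. card (M c)) = (\<Sum>c\<in>{m..<k}. completions r (c - a) (k - 1 - c))"
    using Suc.prems by (intro sum.cong refl) (simp add: M_def Suc.IH)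
  also have "\<dots> = (\<Sum>j\<le>k - 1 - m. completions r (m - a + j) (k - 1 - m - j))"
    using Suc.prems
    by (intro sum.reindex_bij_witness[of _ "\<lambda>j. m + j" "\<lambda>c. c - m"]) auto
  finally show ?case by simp
qed

text \<open>The empty prefix has no maximum, but it behaves like a prefix with maximum and lower bound
  \<open>0\<close>, the smallest letter. Then \<open>k\<close> of the \<open>Suc k\<close> letters lie above the maximum.\<close>

lemma card_words_eq_completions:
  "card (words n {..<Suc k}) = completions n 0 k"
proof -
  have "words n {..<Suc k} = {w. length w = n \<and> set w \<subseteq> {..<Suc k} \<and> safe_from 0 0 w}"
    by (auto simp: words_def safe_from_def)
  then show ?thesis using card_safe_from[of 0 0 "Suc k" n] by simp
qed

section \<open>The Catalan equation\<close>

lemma catalan_gf_quadratic: "catalan_gf = 1 + fps_X * catalan_gf\<^sup>2"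
proof -
  let ?s = "fps_radical (\<lambda>_ _. 1) 2 (1 - 4 * fps_X) :: rat fps"
  have sq: "?s\<^sup>2 = 1 - 4 * fps_X"
    using power_radical[of "1 - 4 * fps_X :: rat fps" "\<lambda>_ _. 1" 1] by (simp add: numeral_2_eq_2)
  have "2 * fps_X dvd 1 - ?s"
  proof -
    have "(1 - ?s) $ 0 = 0" by simp
    then have "1 - ?s = 2 * fps_X * (fps_const (1/2) * fps_shift 1 (1 - ?s))"
      by (intro fps_ext) (auto simp: numeral_fps_const mult.assoc fps_X_mult_nth split: nat.split)
    then show ?thesis by (rule dvdI)
  qed
  then have "catalan_gf * (2 * fps_X) = 1 - ?s"
    unfolding catalan_gf_closed_form by (rule dvd_div_mult_self)
  then have "?s = 1 - catalan_gf * (2 * fps_X)" by (simp add: algebra_simps)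
  with sq have "(1 - catalan_gf * (2 * fps_X))\<^sup>2 = 1 - 4 * fps_X" by simp
  then have "(4 * fps_X) * catalan_gf = (4 * fps_X) * (1 + fps_X * catalan_gf\<^sup>2)"
    by algebra
  then show ?thesis by (simp add: mult_left_cancel)
qed

text \<open>Embedding coefficients as constant series in \<open>x\<close> and composing with \<open>G\<close> are both ring
  homomorphisms, so the quadratic equation survives the substitution.\<close>

lemma subst_xy_catalan_quadratic:
  assumes "G $ 0 = 0"
  shows "subst_xy catalan_gf G = 1 + G * (subst_xy catalan_gf G)\<^sup>2"
proof -
  let ?L = "\<lambda>F :: rat fps. Abs_fps (\<lambda>m. fps_const (F $ m))"
  have mult: "?L (F * F') = ?L F * ?L F'" for F F'
    by (intro fps_ext) (simp add: fps_mult_nth fps_sum_nth)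
  have "?L catalan_gf = ?L (1 + fps_X * catalan_gf\<^sup>2)"
    by (subst catalan_gf_quadratic) (rule refl)
  also have "\<dots> = 1 + fps_X * (?L catalan_gf)\<^sup>2"
    by (simp only: power2_eq_square mult[symmetric])
      (rule fps_ext, auto simp: fps_X_mult_nth)
  finally have "?L catalan_gf oo G = (1 + fps_X * (?L catalan_gf)\<^sup>2) oo G"
    by (rule arg_cong)
  then show ?thesis
    using assms unfolding subst_xy_def
    by (simp add: fps_compose_add_distrib fps_compose_mult_distrib fps_compose_power[symmetric] power2_eq_square)
qed

section \<open>Inverting the binomial transform\<close>

text \<open>The variable \<open>v\<close> marking the alphabet size, written as the series \<open>x / (1 + x)\<close> in the
  variable \<open>x\<close> marking the number of blocks.\<close>

definition v_of_x :: "rat fps" where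
  "v_of_x = fps_X * inverse (1 + fps_X)"

lemma v_of_x_nth_0 [simp]: "v_of_x $ 0 = 0"
  by (simp add: v_of_x_def)

lemma v_of_x_mult: "v_of_x * (1 + fps_X) = fps_X"
  by (simp add: v_of_x_def mult.assoc inverse_mult_eq_1)

text \<open>Under \<open>v = x / (1 + x)\<close> the factor \<open>1 / (1 - v)\<close> becomes \<open>1 + x\<close>.\<close>

lemma compose_v_of_x_eqI:
  assumes "f * (1 - fps_X) = h"
  shows "f oo v_of_x = (h oo v_of_x) * (1 + fps_X)"
proof -
  have "(f oo v_of_x) * (1 - v_of_x) = h oo v_of_x"
    unfolding assms[symmetric] by (simp add: fps_compose_mult_distrib fps_compose_sub_distrib)
  then have "(f oo v_of_x) * ((1 - v_of_x) * (1 + fps_X)) = (h oo v_of_x) * (1 + fps_X)"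
    by (simp add: mult.assoc[symmetric])
  moreover have "(1 - v_of_x) * (1 + fps_X) = 1"
    using v_of_x_mult by (simp add: algebra_simps)
  ultimately show ?thesis by simp
qed

text \<open>The column of Pascal's triangle has the series \<open>v\<^sup>j / (1 - v)\<^sup>j\<^sup>+\<^sup>1\<close>. The induction step is
  Pascal's rule in the form \<open>(1 - v) B\<^sub>j\<^sub>+\<^sub>1 = v B\<^sub>j\<close>.\<close>

lemma binomial_column_compose:
  "Abs_fps (\<lambda>k. of_nat (k choose j)) oo v_of_x = fps_X ^ j * (1 + fps_X)"
proof (induction j)
  case 0
  have "Abs_fps (\<lambda>k. of_nat (k choose 0)) * (1 - fps_X) = (1 :: rat fps)"
    by (rule fps_ext) (auto simp: right_diff_distrib fps_mult_fps_X_commute)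
  from compose_v_of_x_eqI[OF this] show ?case by simp
next
  case (Suc j)
  have "Abs_fps (\<lambda>k. of_nat (k choose Suc j)) * (1 - fps_X)
      = fps_X * (Abs_fps (\<lambda>k. of_nat (k choose j)) :: rat fps)"
  proof (rule fps_ext)
    fix n
    show "(Abs_fps (\<lambda>k. of_nat (k choose Suc j)) * (1 - fps_X)) $ n
      = (fps_X * (Abs_fps (\<lambda>k. of_nat (k choose j)) :: rat fps)) $ n"
      by (cases n) (auto simp: right_diff_distrib fps_mult_fps_X_commute)
  qed
  from compose_v_of_x_eqI[OF this] show ?case
    using Suc v_of_x_mult by (simp add: fps_compose_mult_distrib mult_ac)
qed

text \<open>Finite support of \<open>f\<close> allows the transform to be read as a finite combination of columns of
  Pascal's triangle.\<close>

lemma binomial_transform_compose: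
  fixes f :: "nat \<Rightarrow> rat"
  assumes "\<And>j. n < j \<Longrightarrow> f j = 0"
  shows "Abs_fps (\<lambda>k. \<Sum>j\<le>k. of_nat (k choose j) * f j) oo v_of_x = (1 + fps_X) * Abs_fps f"
proof -
  let ?B = "\<lambda>j. Abs_fps (\<lambda>k. of_nat (k choose j)) :: rat fps"
  have "(\<Sum>j\<le>k. of_nat (k choose j) * f j) = (\<Sum>j\<le>n. of_nat (k choose j) * f j)" for k
    using assms by (intro sum.mono_neutral_cong) (auto simp: not_le binomial_eq_0)
  then have "Abs_fps (\<lambda>k. \<Sum>j\<le>k. of_nat (k choose j) * f j) = (\<Sum>j\<le>n. fps_const (f j) * ?B j)"
    by (intro fps_ext) (simp add: fps_sum_nth mult.commute)
  also have "\<dots> oo v_of_x = (\<Sum>j\<le>n. fps_const (f j) * (fps_X ^ j * (1 + fps_X)))"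
    by (simp add: fps_compose_sum_distrib fps_compose_mult_distrib binomial_column_compose)
  also have "\<dots> = (1 + fps_X) * (\<Sum>j\<le>n. fps_const (f j) * fps_X ^ j)"
    by (simp add: sum_distrib_left mult_ac)
  also have "(\<Sum>j\<le>n. fps_const (f j) * fps_X ^ j) = Abs_fps f"
  proof (rule fps_ext)
    fix k
    have "(\<Sum>j\<le>n. fps_const (f j) * fps_X ^ j) $ k = (\<Sum>j\<le>n. if j = k then f j else 0)"
      unfolding fps_sum_nth by (intro sum.cong) (auto simp: fps_X_power_nth)
    then show "(\<Sum>j\<le>n. fps_const (f j) * fps_X ^ j) $ k = Abs_fps f $ k"
      using assms[of k] by (auto simp: not_le)
  qed
  finally show ?thesis .
qed

section \<open>Solving the recurrence\<close>

text \<open>The series \<open>v\<close> is divisible by \<open>x\<close>, so iterating the recurrence makes \<open>D d\<close> divisible by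
  every power of \<open>x\<close>. This replaces convergence arguments for the infinite sums
  \<open>\<Sum>\<^sub>j v\<^sup>j W\<^sub>d\<^sub>+\<^sub>j\<close>.\<close>

lemma zero_if_v_of_x_recurrence:
  fixes D :: "nat \<Rightarrow> rat fps"
  assumes "\<And>d. D d = v_of_x * D (Suc d)"
  shows "D d = 0"
proof -
  have pow: "D d = v_of_x ^ m * D (d + m)" for m
    by (induction m) (simp, metis assms add_Suc_right mult.assoc power_Suc2)
  show ?thesis
  proof (rule fps_ext)
    fix n
    have "D d = fps_X ^ Suc n * (inverse (1 + fps_X) ^ Suc n * D (d + Suc n))"
      using pow[of "Suc n"] by (simp only: v_of_x_def power_mult_distrib mult.assoc)
    also have "\<dots> $ n = 0" by (simp only: fps_X_power_mult_nth) simp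
    finally show "D d $ n = 0 $ n" by simp
  qed
qed

text \<open>The geometric form \<open>W\<^sub>d = g A\<^sup>d\<close>. The series \<open>H\<close> is the value of \<open>\<Sum>\<^sub>j v\<^sup>j W\<^sub>j = g / (1 - v A)\<close>:
  its equation has been multiplied by \<open>1 + x\<close>, because \<open>(1 + x) v = x\<close>. The second hypothesis is
  the recurrence for \<open>d = 0\<close>, and given the second, the third amounts to the difference of the
  recurrences for \<open>d + 1\<close> and \<open>d\<close>.\<close>

lemma completions_gf_geometric:
  fixes g A H :: "rat fps fps"
  assumes H: "H * (1 + var_x - var_x * A) = (1 + var_x) * g"
    and g: "g = 1 + var_x + var_y * H"
    and A: "(1 + var_x) * (A - 1) = var_y * g * A"
  shows "Abs_fps (\<lambda>e. of_nat (completions r d e)) oo v_of_x = (g * A ^ d) $ r"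
proof (induction r arbitrary: d)
  case 0
  have "Abs_fps (\<lambda>e. of_nat (completions 0 d e)) * (1 - fps_X) = (1 :: rat fps)"
    by (rule fps_ext) (auto simp: right_diff_distrib fps_mult_fps_X_commute)
  then have l: "Abs_fps (\<lambda>e. of_nat (completions 0 d e)) oo v_of_x = 1 + fps_X"
    using compose_v_of_x_eqI[of _ 1] by simp
  have "g $ 0 = 1 + fps_X" by (subst g) simp
  moreover have "A $ 0 = 1"
  proof -
    have "(1 + fps_X) * (A $ 0 - 1) = 0"
      using arg_cong[OF A, of "\<lambda>F. F $ 0"] by (simp add: mult.assoc)
    moreover have "(1 + fps_X :: rat fps) \<noteq> 0"
      by (metis add_0 fps_add_nth fps_X_nth fps_one_nth fps_zero_nth one_neq_zero add.right_neutral zero_neq_one)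
    ultimately show ?thesis by simp
  qed
  ultimately have "(g * A ^ d) $ 0 = 1 + fps_X" by (simp add: fps_power_zeroth)
  with l show ?case by simp
next
  case (Suc r)
  define W where "W d = (Abs_fps (\<lambda>e. of_nat (completions r d e)) :: rat fps)" for d
  define T where "T d = (Abs_fps (\<lambda>e. \<Sum>j\<le>e. of_nat (completions r (d + j) (e - j))) :: rat fps)" for d
  have W: "W d oo v_of_x = (g * A ^ d) $ r" for d
    unfolding W_def by (rule Suc)
  have H_shift: "H * A ^ d = g * A ^ d + fps_const v_of_x * (H * A ^ Suc d)" for d
  proof -
    have v: "fps_const v_of_x * (1 + var_x) = var_x"
      using arg_cong[OF v_of_x_mult, of fps_const]
      by (simp add: fps_const_mult[symmetric] fps_const_add[symmetric] del: fps_const_mult fps_const_add)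
    have nz: "(1 + var_x) \<noteq> 0"
    proof
      assume "1 + var_x = 0"
      then have "(1 + var_x) $ 0 $ 0 = 0" by (simp only: fps_zero_nth)
      then show False by simp
    qed
    have "(1 + var_x) * (H * A ^ d) = (1 + var_x) * (g * A ^ d + fps_const v_of_x * (H * A ^ Suc d))"
    proof -
      have "(1 + var_x) * (g * A ^ d + fps_const v_of_x * (H * A ^ Suc d))
          = (1 + var_x) * g * A ^ d + fps_const v_of_x * (1 + var_x) * H * A * A ^ d"
        by (simp only: power_Suc distrib_left mult_ac)
      also have "\<dots> = (1 + var_x) * (H * A ^ d)"
        unfolding v H[symmetric] by (simp add: algebra_simps)
      finally show ?thesis by (rule sym)
    qed
    with nz show ?thesis by simp
  qed
  \<comment> \<open>\<open>T d\<close> is the infinite sum \<open>\<Sum>\<^sub>j v\<^sup>j W\<^sub>d\<^sub>+\<^sub>j\<close>. Splitting off its first term gives it the same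
    one-step recurrence as \<open>H A\<^sup>d\<close>.\<close>
  have T: "T d oo v_of_x = (H * A ^ d) $ r" for d
  proof -
    have Ts: "T d = W d + fps_X * T (Suc d)" for d
    proof (rule fps_ext)
      fix e
      show "T d $ e = (W d + fps_X * T (Suc d)) $ e"
        by (cases e) (simp_all add: T_def W_def sum.atMost_Suc_shift del: sum.atMost_Suc)
    qed
    have "(T d oo v_of_x) - (H * A ^ d) $ r = v_of_x * ((T (Suc d) oo v_of_x) - (H * A ^ Suc d) $ r)" for d
    proof -
      have "T d oo v_of_x = (g * A ^ d) $ r + v_of_x * (T (Suc d) oo v_of_x)"
        by (subst Ts) (simp add: fps_compose_add_distrib fps_compose_mult_distrib W)
      moreover have "(H * A ^ d) $ r = (g * A ^ d) $ r + v_of_x * (H * A ^ Suc d) $ r"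
        by (subst H_shift) simp
      ultimately show ?thesis by (simp add: algebra_simps)
    qed
    from zero_if_v_of_x_recurrence[of "\<lambda>d. (T d oo v_of_x) - (H * A ^ d) $ r", OF this, of d]
    show ?thesis by simp
  qed
  \<comment> \<open>\<open>g A\<^sup>d\<close> satisfies the recurrence of \<open>W\<^sub>d\<close>.\<close>
  have step: "g * A ^ d = 1 + var_x + var_y * ((\<Sum>i=1..d. g * A ^ i) + H * A ^ d)"
  proof (induction d)
    case 0
    then show ?case using g by simp
  next
    case (Suc d)
    have "g * A ^ Suc d - g * A ^ d = var_y * (g * A ^ Suc d + H * A ^ Suc d - H * A ^ d)"
    proof -
      have yH: "var_y * H = g - (1 + var_x)" using g by (simp add: algebra_simps)
      have "var_y * (g * A ^ Suc d + H * A ^ Suc d - H * A ^ d)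
          = var_y * g * A * A ^ d + var_y * H * (A - 1) * A ^ d"
        by (simp only: power_Suc distrib_left distrib_right left_diff_distrib right_diff_distrib mult_ac)
          simp
      also have "\<dots> = g * A ^ Suc d - g * A ^ d"
        unfolding A[symmetric] yH by (simp add: algebra_simps)
      finally show ?thesis by (rule sym)
    qed
    then have "g * A ^ Suc d = g * A ^ d + var_y * (g * A ^ Suc d + H * A ^ Suc d - H * A ^ d)"
      by (simp only: diff_eq_eq add.commute)
    also have "g * A ^ d = 1 + var_x + var_y * ((\<Sum>i=1..d. g * A ^ i) + H * A ^ d)"
      by (rule Suc.IH)
    also have "\<dots> + var_y * (g * A ^ Suc d + H * A ^ Suc d - H * A ^ d)
        = 1 + var_x + var_y * ((\<Sum>i=1..d. g * A ^ i) + H * A ^ d + (g * A ^ Suc d + H * A ^ Suc d - H * A ^ d))"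
      by (simp only: distrib_left add.assoc)
    also have "(\<Sum>i=1..d. g * A ^ i) + H * A ^ d + (g * A ^ Suc d + H * A ^ Suc d - H * A ^ d)
        = (\<Sum>i=1..Suc d. g * A ^ i) + H * A ^ Suc d"
      by simp
    finally show ?case .
  qed
  have "Abs_fps (\<lambda>e. of_nat (completions (Suc r) d e)) = (\<Sum>i=1..d. W i) + T d"
    by (rule fps_ext) (simp add: W_def T_def fps_sum_nth)
  also have "\<dots> oo v_of_x = ((\<Sum>i=1..d. g * A ^ i) + H * A ^ d) $ r"
    by (simp add: fps_compose_add_distrib fps_compose_sum_distrib W T fps_sum_nth)
  also have "\<dots> = (g * A ^ d) $ Suc r"
    by (subst step) simp
  finally show ?case .
qed


text \<open>Eliminating \<open>g\<close> and \<open>H\<close> from the three equations leaves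
  \<open>(1 - 2y) (A - 1) = y + x (1 - y) (A - 1)\<^sup>2\<close>, which is the equation for \<open>c\<close> after the scaling
  \<open>A - 1 = y c / (1 - 2y)\<close>. Here \<open>p\<close> and \<open>q\<close> stand for \<open>1 / (1 - y)\<close> and \<open>1 / (1 - 2y)\<close>.\<close>

lemma geometric_parameters_of_quadratic:
  fixes c p q :: "rat fps fps"
  defines "A \<equiv> 1 + var_y * q * c" and "g \<equiv> p + var_x * q * c"
  assumes p: "p * (1 - var_y) = 1" and q: "q * (1 - 2 * var_y) = 1"
    and c: "c = 1 + var_x * var_y * (1 - var_y) * q\<^sup>2 * c\<^sup>2"
  obtains H where "H * (1 + var_x - var_x * A) = (1 + var_x) * g"
    and "g = 1 + var_x + var_y * H"
    and "(1 + var_x) * (A - 1) = var_y * g * A"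
proof -
  \<comment> \<open>With \<open>x\<close> and \<open>y\<close> generalised to free variables, each identity becomes membership in a
    polynomial ideal.\<close>
  have "\<And>x y :: rat fps fps. p * (1 - y) = 1 \<Longrightarrow> q * (1 - 2 * y) = 1 \<Longrightarrow>
    c = 1 + x * y * (1 - y) * q\<^sup>2 * c\<^sup>2 \<Longrightarrow>
    (1 + x) * (y * q * c) = y * (p + x * q * c) * (1 + y * q * c)"
    by algebra
  from this[OF p q c] have A: "(1 + var_x) * (A - 1) = var_y * g * A"
    unfolding A_def g_def by simp
  \<comment> \<open>The quotient \<open>(g - 1 - x) / y\<close>, made explicit by \<open>p - 1 = y p\<close>, \<open>q - 1 = 2 y q\<close> and the equation
    for \<open>c\<close>.\<close>
  define H where "H = p + var_x * q * (var_x * (1 - var_y) * q\<^sup>2 * c\<^sup>2 + 2)"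
  have "\<And>x y :: rat fps fps. p * (1 - y) = 1 \<Longrightarrow> q * (1 - 2 * y) = 1 \<Longrightarrow>
    c = 1 + x * y * (1 - y) * q\<^sup>2 * c\<^sup>2 \<Longrightarrow>
    p + x * q * c = 1 + x + y * (p + x * q * (x * (1 - y) * q\<^sup>2 * c\<^sup>2 + 2))"
    by algebra
  from this[OF p q c] have g: "g = 1 + var_x + var_y * H"
    unfolding H_def g_def by simp
  have "\<And>x y :: rat fps fps. p * (1 - y) = 1 \<Longrightarrow> q * (1 - 2 * y) = 1 \<Longrightarrow>
    c = 1 + x * y * (1 - y) * q\<^sup>2 * c\<^sup>2 \<Longrightarrow>
    (p + x * q * (x * (1 - y) * q\<^sup>2 * c\<^sup>2 + 2)) * (1 - x * (y * q * c)) = (1 + x) * (p + x * q * c)"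
    by algebra
  from this[OF p q c] have "H * (1 + var_x - var_x * A) = (1 + var_x) * g"
    unfolding H_def g_def A_def by (simp add: algebra_simps)
  with g A show ?thesis using that by blast
qed


section \<open>The generating function of the ordered partitions\<close>

text \<open>The words over all alphabets have the series \<open>1 + v g\<close>: the empty alphabet admits only the
  empty word, and an alphabet with \<open>e + 1\<close> letters contributes to \<open>v\<^sup>e\<^sup>+\<^sup>1\<close>. By the binomial
  transform this is \<open>(1 + x) P\<close>, and \<open>(1 + x) v = x\<close>.\<close>

lemma op321_gf_functional_equation:
  fixes g A H :: "rat fps fps"
  assumes "H * (1 + var_x - var_x * A) = (1 + var_x) * g"
    and "g = 1 + var_x + var_y * H"
    and "(1 + var_x) * (A - 1) = var_y * g * A"
  shows "(1 + var_x)\<^sup>2 * Abs_fps (\<lambda>n. Abs_fps (\<lambda>k. of_nat (op321 n k))) = 1 + var_x + var_x * g"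
proof -
  let ?P = "\<lambda>n. Abs_fps (\<lambda>k. of_nat (op321 n k)) :: rat fps"
  let ?W = "\<lambda>n. Abs_fps (\<lambda>e. of_nat (completions n 0 e)) :: rat fps"
  have row: "(1 + fps_X) * ?P n = (if n = 0 then 1 else 0) + v_of_x * g $ n" for n
  proof -
    have empty: "card (words n {..<0}) = (if n = 0 then 1 else 0)"
      using card_words_binomial[of n 0] by (simp add: op321_zero_blocks)
    have "(1 + fps_X) * ?P n = Abs_fps (\<lambda>k. \<Sum>j\<le>k. of_nat (k choose j) * of_nat (op321 n j)) oo v_of_x"
      by (rule binomial_transform_compose[symmetric, of n]) (simp add: op321_eq_0)
    also have "Abs_fps (\<lambda>k. \<Sum>j\<le>k. of_nat (k choose j) * of_nat (op321 n j))
        = Abs_fps (\<lambda>k. of_nat (card (words n {..<k})) :: rat)"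
      by (simp add: card_words_binomial)
    also have "\<dots> = fps_const (if n = 0 then 1 else 0) + fps_X * ?W n"
    proof (rule fps_ext)
      fix k
      show "Abs_fps (\<lambda>k. of_nat (card (words n {..<k})) :: rat) $ k
          = (fps_const (if n = 0 then 1 else 0) + fps_X * ?W n) $ k"
        using empty by (cases k) (simp_all add: card_words_eq_completions del: lessThan_0)
    qed
    also have "\<dots> oo v_of_x = (if n = 0 then 1 else 0) + v_of_x * g $ n"
      using completions_gf_geometric[OF assms, of n 0]
      by (simp add: fps_compose_add_distrib fps_compose_mult_distrib)
    finally show ?thesis .
  qed
  have "(1 + fps_X)\<^sup>2 * ?P n = (if n = 0 then 1 + fps_X else 0) + fps_X * g $ n" for n
  proof -
    have "(1 + fps_X)\<^sup>2 * ?P n = (1 + fps_X) * ((1 + fps_X) * ?P n)"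
      by (simp only: power2_eq_square mult.assoc)
    also have "\<dots> = (if n = 0 then 1 + fps_X else 0) + v_of_x * (1 + fps_X) * g $ n"
      unfolding row by (simp add: algebra_simps)
    finally show ?thesis unfolding v_of_x_mult .
  qed
  moreover have "(1 + var_x)\<^sup>2 = fps_const ((1 + fps_X)\<^sup>2)"
    by (simp add: fps_const_power[symmetric] fps_const_add[symmetric] del: fps_const_power fps_const_add)
  ultimately show ?thesis
    by (intro fps_ext) (simp only: fps_mult_left_const_nth, simp)
qed

theorem theorem3p4:
  shows "Abs_fps (\<lambda>n. Abs_fps (\<lambda>k. if n \<ge> k then of_nat (op321 n k) else 0)) =
     1 / (1 + var_x)
     + var_x / ((1 + var_x)\<^sup>2 * (1 - var_y))
     + var_x\<^sup>2 / ((1 + var_x)\<^sup>2 * (1 - 2 * var_y))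
         * subst_xy catalan_gf (var_x * var_y * (1 - var_y) / (1 - 2 * var_y)\<^sup>2)"
    (is "?L = ?T1 + ?T2 + ?T3 * ?c")
proof -
  define p where "p = 1 / (1 - var_y)"
  define q where "q = 1 / (1 - 2 * var_y)"
  let ?Z = "var_x * var_y * (1 - var_y) / (1 - 2 * var_y)\<^sup>2"
  have p: "p * (1 - var_y) = 1" and q: "q * (1 - 2 * var_y) = 1"
    unfolding p_def q_def by (rule divide_xy_unit; simp)+
  have "?Z = var_x * var_y * (1 - var_y) * q\<^sup>2"
  proof -
    have "?Z * (1 - 2 * var_y)\<^sup>2 = var_x * var_y * (1 - var_y)"
      by (rule divide_xy_unit) (simp add: fps_power_zeroth)
    then have "var_x * var_y * (1 - var_y) * q\<^sup>2 = ?Z * (q * (1 - 2 * var_y))\<^sup>2"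
      by (simp only: power_mult_distrib mult_ac)
    then show ?thesis by (simp add: q)
  qed
  then have c: "?c = 1 + var_x * var_y * (1 - var_y) * q\<^sup>2 * ?c\<^sup>2"
    using subst_xy_catalan_quadratic[OF substituted_series_constant_coeff] by simp
  obtain H where "H * (1 + var_x - var_x * (1 + var_y * q * ?c)) = (1 + var_x) * (p + var_x * q * ?c)"
    and "p + var_x * q * ?c = 1 + var_x + var_y * H"
    and "(1 + var_x) * (1 + var_y * q * ?c - 1) = var_y * (p + var_x * q * ?c) * (1 + var_y * q * ?c)"
    using geometric_parameters_of_quadratic[OF p q c] by blast
  then have "(1 + var_x)\<^sup>2 * Abs_fps (\<lambda>n. Abs_fps (\<lambda>k. of_nat (op321 n k)))
      = 1 + var_x + var_x * (p + var_x * q * ?c)"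
    by (rule op321_gf_functional_equation)
  moreover have "Abs_fps (\<lambda>n. Abs_fps (\<lambda>k. of_nat (op321 n k))) = ?L"
    by (intro fps_ext) (simp add: op321_eq_0)
  ultimately have L: "(1 + var_x)\<^sup>2 * ?L = 1 + var_x + var_x * (p + var_x * q * ?c)" by simp
  have T1: "?T1 * (1 + var_x) = 1"
    by (rule divide_xy_unit) simp
  have T2: "?T2 * ((1 + var_x)\<^sup>2 * (1 - var_y)) = var_x"
    by (rule divide_xy_unit) (simp add: fps_power_zeroth)
  have T3: "?T3 * ((1 + var_x)\<^sup>2 * (1 - 2 * var_y)) = var_x\<^sup>2"
    by (rule divide_xy_unit) (simp add: fps_power_zeroth)
  have "(1 + var_x)\<^sup>2 * (?T1 + ?T2 + ?T3 * ?c) = 1 + var_x + var_x * (p + var_x * q * ?c)"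
  proof -
    have "(1 + var_x)\<^sup>2 * ?T1 = 1 + var_x"
      using T1 by (simp add: power2_eq_square mult.assoc mult.commute[of _ ?T1])
    moreover have "(1 + var_x)\<^sup>2 * ?T2 = var_x * p"
    proof -
      have "(1 + var_x)\<^sup>2 * ?T2 = p * (1 - var_y) * ((1 + var_x)\<^sup>2 * ?T2)" unfolding p by simp
      also have "\<dots> = ?T2 * ((1 + var_x)\<^sup>2 * (1 - var_y)) * p" by (simp only: mult_ac)
      finally show ?thesis unfolding T2 .
    qed
    moreover have "(1 + var_x)\<^sup>2 * ?T3 = var_x\<^sup>2 * q"
    proof -
      have "(1 + var_x)\<^sup>2 * ?T3 = q * (1 - 2 * var_y) * ((1 + var_x)\<^sup>2 * ?T3)" unfolding q by simp
      also have "\<dots> = ?T3 * ((1 + var_x)\<^sup>2 * (1 - 2 * var_y)) * q" by (simp only: mult_ac)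
      finally show ?thesis unfolding T3 .
    qed
    ultimately show ?thesis
      by (simp only: distrib_left mult.assoc[symmetric] power2_eq_square) (simp only: mult_ac add_ac)
  qed
  with L have "(1 + var_x)\<^sup>2 * ?L = (1 + var_x)\<^sup>2 * (?T1 + ?T2 + ?T3 * ?c)" by simp
  moreover have "(1 + var_x)\<^sup>2 \<noteq> 0"
  proof
    assume "(1 + var_x)\<^sup>2 = 0"
    then have "(1 + var_x)\<^sup>2 $ 0 $ 0 = 0" by (simp only: fps_zero_nth)
    then show False by (simp add: fps_power_zeroth)
  qed
  ultimately show ?thesis by (simp only: mult_left_cancel not_False_eq_True)
qed

end
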